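(* Let $n\ge 1$, let $A_n=(n,f_n)$ be an NCCA, and let $T_{A_n}$ be a bundle tree of $A_n$, with associated sequence of pattern sets $P_n,P_{n-1},\dots,P_1$. For $1\le i\le n$ let $A_i=(i,f_i)$ be the CA of neighborhood size $i$ whose value-1 pattern set is $P_i$. Then for every $i$ with $1\le i\le n$, $A_i$ is an NCCA of neighborhood size $i$.
   Context: A (1-dimensional, 2-state) cellular automaton (CA) of neighborhood size $n\ge 1$ (an $n$-cell CA) is a pair $A=(n,f)$ with local function $f:\{0,1\}^n\to\{0,1\}$. Its global function $F$ acts on configurations $c:\mathbb{Z}\to\{0,1\}$ by $F(c)(i)=f(c(i)c(i+1)\cdots c(i+n-1))$. $A$ is number-conserving (an NCCA) if for every finite configuration $c$ (finitely many cells in state $1$), $F(c)$ is also finite and $\sum_{i\in\mathbb{Z}}(F(c)(i)-c(i))=0$, i.e. $c$ and $F(c)$ have the same number of 1s. The value-1 pattern set of $A=(n,f)$ is $P_A=\{p\in\{0,1\}^n : f(p)=1\}$. Let $P\subseteq\{0,1\}^m$ with $m\ge 2$. Two patterns $p,q\in P$ can be paired if $\{p,q\}=\{0r,1r\}$ or $\{p,q\}=\{r0,r1\}$ for some $r\in\{0,1\}^{m-1}$; this (unique) $r$ is called the bundle pattern of the pair. A bundle pattern set of $P$ is a set $\hat P\subseteq\{0,1\}^{m-1}$ for which there is a partition of $P$ into two-element sets $\{p,q\}$ that can be paired such that $\hat P$ is the set of the bundle patterns of these pairs. Bundle tree: let $A_n=(n,f_n)$ be an NCCA and let $P_n$ be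 its value-1 pattern set. Suppose $P_n,P_{n-1},\dots,P_1$ is a sequence with $P_i\subseteq\{0,1\}^i$ and $|P_i|=2^{i-1}$ for $1\le i\le n$, and such that $P_{i-1}$ is a bundle pattern set of $P_i$ for $2\le i\le n$, with a fixed partition of $P_i$ into pairs realizing it. Then each $r\in P_i$ ($1\le i\le n-1$) is the bundle pattern of exactly one pair $\{p,q\}$ of the partition of $P_{i+1}$. The associated bundle tree $T_{A_n}=(V,E)$ of $A_n$ is the graph whose vertex set $V$ is the union of all $P_i$, $1\le i\le n$, and whose edges are all $(r,p)$ and $(r,q)$ with $r\in P_i$, $1\le i\le n-1$, and $\{p,q\}$ the pair of the partition of $P_{i+1}$ with bundle pattern $r$. *)

theory Defs
  imports Main "HOL-Library.Disjoint_Sets" "HOL-Library.Groups_Big_Fun"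
begin

text \<open>
  The states 0 and 1 are \<^term>\<open>False\<close> and \<^term>\<open>True\<close>; a pattern in \<open>{0,1}\<^sup>n\<close> is a
  Boolean list of length \<open>n\<close>. A cellular automaton \<open>(n, f)\<close> is given by its neighborhood
  size \<open>n\<close> and a local function \<open>f\<close>, of which only the values on lists of length \<open>n\<close> matter.
\<close>

definition global_fun :: "nat \<Rightarrow> (bool list \<Rightarrow> bool) \<Rightarrow> (int \<Rightarrow> bool) \<Rightarrow> (int \<Rightarrow> bool)" where
  "global_fun n f c = (\<lambda>i. f (map (\<lambda>j. c (i + int j)) [0..<n]))"

definition finite_config :: "(int \<Rightarrow> bool) \<Rightarrow> bool" where
  "finite_config c \<longleftrightarrow> finite {i. c i}"

text \<open>
  \<^const>\<open>Sum_any\<close> sums over the support of the summand, which is finite here since both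
  \<open>c\<close> and its image are finite configurations.
\<close>

definition ncca :: "nat \<Rightarrow> (bool list \<Rightarrow> bool) \<Rightarrow> bool" where
  "ncca n f \<longleftrightarrow> 1 \<le> n \<and>
     (\<forall>c. finite_config c \<longrightarrow>
        finite_config (global_fun n f c) \<and>
        Sum_any (\<lambda>i. of_bool (global_fun n f c i) - of_bool (c i) :: int) = 0)"

definition value1_patterns :: "nat \<Rightarrow> (bool list \<Rightarrow> bool) \<Rightarrow> bool list set" where
  "value1_patterns n f = {p. length p = n \<and> f p}"

text \<open>
  \<open>bundle_pattern B r\<close>: the members of the two-element set \<open>B\<close> can be paired, with bundle
  pattern \<open>r\<close>. The length of \<open>r\<close> is one less than that of the members of \<open>B\<close>.
\<close>

definition bundle_pattern :: "bool list set \<Rightarrow> bool list \<Rightarrow> bool" where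
  "bundle_pattern B r \<longleftrightarrow>
     B = {False # r, True # r} \<or> B = {r @ [False], r @ [True]}"

definition pair_partition :: "bool list set \<Rightarrow> bool list set set \<Rightarrow> bool" where
  "pair_partition P \<B> \<longleftrightarrow>
     partition_on P \<B> \<and> (\<forall>B\<in>\<B>. card B = 2 \<and> (\<exists>r. bundle_pattern B r))"

text \<open>\<open>Q\<close> is a bundle pattern set of \<open>P\<close>, as witnessed by the partition \<open>\<B>\<close>.\<close>

definition realizes_bundle_pattern_set ::
    "bool list set \<Rightarrow> bool list set set \<Rightarrow> bool list set \<Rightarrow> bool" where
  "realizes_bundle_pattern_set P \<B> Q \<longleftrightarrow>
     pair_partition P \<B> \<and> Q = {r. \<exists>B\<in>\<B>. bundle_pattern B r}"

text \<open>
  \<open>\<B> i\<close> is the fixed partition of \<open>P i\<close> that realizes \<open>P (i - 1)\<close>; only \<open>2 \<le> i \<le> n\<close>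
  matters. A graph is the pair of its vertex set and its edge set.
\<close>

definition bundle_tree ::
    "nat \<Rightarrow> (bool list \<Rightarrow> bool) \<Rightarrow> (nat \<Rightarrow> bool list set) \<Rightarrow> (nat \<Rightarrow> bool list set set) \<Rightarrow>
     bool list set \<times> (bool list \<times> bool list) set \<Rightarrow> bool" where
  "bundle_tree n f P \<B> T \<longleftrightarrow>
     P n = value1_patterns n f \<and>
     (\<forall>i\<in>{1..n}. P i \<subseteq> {p. length p = i} \<and> card (P i) = 2 ^ (i - 1)) \<and>
     (\<forall>i\<in>{2..n}. realizes_bundle_pattern_set (P i) (\<B> i) (P (i - 1))) \<and>
     T = (\<Union>i\<in>{1..n}. P i,
          {(r, p). \<exists>i\<in>{1..<n}. r \<in> P i \<and> (\<exists>B\<in>\<B> (i + 1). bundle_pattern B r \<and> p \<in> B)})"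

end

(* The number of ones in F(c) is the number of occurrences in c of value-1 patterns. Each occurrence
   of a nonzero pattern r extends uniquely to one of 0r, 1r, and to one of r0, r1, so replacing every
   pair by its bundle pattern does not change this count. The all-zero pattern, which alone occurs
   infinitely often, never enters, since any pair that yields it contains a longer all-zero pattern. *)

theory Submission
  imports Defs
begin

definition occs :: "(int \<Rightarrow> bool) \<Rightarrow> bool list \<Rightarrow> int set" where
  "occs c p = {i. map (\<lambda>j. c (i + int j)) [0..<length p] = p}"

lemma mem_occs_iff: "i \<in> occs c p \<longleftrightarrow> (\<forall>j<length p. c (i + int j) = p ! j)"
  unfolding occs_def mem_Collect_eq list_eq_iff_nth_eq by simp

lemma mem_occs_snoc: "i \<in> occs c (r @ [x]) \<longleftrightarrow> i \<in> occs c r \<and> c (i + int (length r)) = x"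
  by (auto simp: mem_occs_iff nth_append less_Suc_eq)

lemma mem_occs_Cons: "i \<in> occs c (x # r) \<longleftrightarrow> c i = x \<and> i + 1 \<in> occs c r"
  by (auto simp: mem_occs_iff less_Suc_eq_0_disj algebra_simps)

lemma finite_occs:
  assumes "finite_config c" and "True \<in> set p"
  shows "finite (occs c p)"
proof -
  obtain j where j: "j < length p" "p ! j = True"
    using assms(2) by (metis in_set_conv_nth)
  \<comment> \<open>The \<open>j\<close>-th cell of an occurrence is one of the finitely many ones
    of \<open>c\<close>, and it determines where the occurrence starts.\<close>
  have "occs c p \<subseteq> (\<lambda>i. i - int j) ` {i. c i}"
  proof
    fix i assume "i \<in> occs c p"
    then have "c (i + int j)" using j by (simp add: mem_occs_iff)
    then show "i \<in> (\<lambda>i. i - int j) ` {i. c i}"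
      by (intro image_eqI[where x = "i + int j"]) auto
  qed
  then show ?thesis
    using assms(1) by (auto simp: finite_config_def intro: finite_subset)
qed

lemma card_occs_bundle:
  assumes "finite_config c" and "True \<in> set r" and "bundle_pattern B r"
  shows "(\<Sum>p\<in>B. card (occs c p)) = card (occs c r)"
  using assms(3) unfolding bundle_pattern_def
proof
  assume B: "B = {False # r, True # r}"
  \<comment> \<open>Prepending a cell moves the start of an occurrence one place to the left, hence
    the shift; appending a cell, in the other case, leaves the start where it is.\<close>
  have "occs c (False # r) \<union> occs c (True # r) = (\<lambda>i. i - 1) ` occs c r"
    by (auto simp: mem_occs_Cons image_iff) (metis add_diff_cancel)+
  moreover have "card ((\<lambda>i. i - 1) ` occs c r) = card (occs c r)"
    by (intro card_image) (auto simp: inj_on_def)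
  moreover have "occs c (False # r) \<inter> occs c (True # r) = {}"
    by (auto simp: mem_occs_Cons)
  ultimately show ?thesis
    using B finite_occs[OF assms(1)] assms(2) by (simp add: card_Un_disjoint[symmetric])
next
  assume B: "B = {r @ [False], r @ [True]}"
  have "occs c (r @ [False]) \<union> occs c (r @ [True]) = occs c r"
    by (auto simp: mem_occs_snoc)
  moreover have "occs c (r @ [False]) \<inter> occs c (r @ [True]) = {}"
    by (auto simp: mem_occs_snoc)
  ultimately show ?thesis
    using B finite_occs[OF assms(1)] assms(2) by (simp add: card_Un_disjoint[symmetric])
qed

text \<open>The first cells tell the two kinds of pair apart: they vary in {0r, 1r} and agree in
  {r0, r1}. Once the kind is known, \<open>tl\<close> or \<open>butlast\<close> recovers r. For
  empty r the two kinds coincide.\<close>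

lemma bundle_pattern_images:
  assumes "bundle_pattern B r" and "r \<noteq> []"
  shows "(tl ` B = {r} \<and> hd ` B = UNIV) \<or> (butlast ` B = {r} \<and> hd ` B = {hd r})"
  using assms(1) unfolding bundle_pattern_def
proof
  assume "B = {False # r, True # r}"
  then show ?thesis by (simp add: UNIV_bool)
next
  assume "B = {r @ [False], r @ [True]}"
  then show ?thesis using assms(2) by simp
qed

lemma bundle_pattern_length:
  assumes "bundle_pattern B r"
  shows "length ` B = {Suc (length r)}"
  using assms unfolding bundle_pattern_def by (elim disjE) simp_all

lemma bundle_pattern_unique:
  assumes "bundle_pattern B r" and "bundle_pattern B s" and "r \<noteq> []"
  shows "r = s"
proof -
  have "s \<noteq> []"
    using assms(1,2)[THEN bundle_pattern_length] assms(3) by auto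
  \<comment> \<open>Varying and constant first cells exclude each other, so \<open>r\<close> and
    \<open>s\<close> arise from the same kind of pair.\<close>
  moreover have "UNIV \<noteq> {x}" for x :: bool
    by (cases x) (simp_all add: UNIV_bool doubleton_eq_iff)
  ultimately show ?thesis
    using bundle_pattern_images[OF assms(1,3)] bundle_pattern_images[OF assms(2)]
    by (metis singleton_inject)
qed

text \<open>Adding a zero at either end of the zero pattern gives the longer zero pattern, and each
  kind of pair contains such an extension.\<close>

lemma bundle_pattern_zero:
  "bundle_pattern B (replicate m False) \<Longrightarrow> replicate (Suc m) False \<in> B"
  by (auto simp: bundle_pattern_def replicate_append_same)

lemma True_in_set_iff: "True \<in> set p \<longleftrightarrow> p \<noteq> replicate (length p) False"
  by (metis (full_types) in_set_replicate replicate_length_same)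

lemma finite_value1_patterns: "finite (value1_patterns m g)"
  using finite_lists_length_eq[of "UNIV :: bool set" m]
  by (auto simp: value1_patterns_def intro: rev_finite_subset)

lemma support_global_fun:
  "{i. global_fun m g c i} = (\<Union>p\<in>value1_patterns m g. occs c p)"
proof (intro set_eqI iffI)
  fix i assume "i \<in> {i. global_fun m g c i}"
  then show "i \<in> (\<Union>p\<in>value1_patterns m g. occs c p)"
    by (intro UN_I[where a = "map (\<lambda>j. c (i + int j)) [0..<m]"])
      (auto simp: global_fun_def value1_patterns_def occs_def)
qed (auto simp: global_fun_def value1_patterns_def occs_def)

text \<open>Without the zero pattern, every value-1 pattern contains a one and so occurs finitely
  often. Different patterns of the same length never occur at the same position, so the numbers of
  occurrences add up.\<close>

lemma finite_config_global_fun: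
  assumes "finite_config c" and "replicate m False \<notin> value1_patterns m g"
  shows "finite_config (global_fun m g c)"
    and "card {i. global_fun m g c i} = (\<Sum>p\<in>value1_patterns m g. card (occs c p))"
proof -
  have fin: "finite (occs c p)" if "p \<in> value1_patterns m g" for p
    using that assms
    by (intro finite_occs) (auto simp: True_in_set_iff value1_patterns_def)
  then show "finite_config (global_fun m g c)"
    by (simp add: finite_config_def support_global_fun finite_value1_patterns)
  show "card {i. global_fun m g c i} = (\<Sum>p\<in>value1_patterns m g. card (occs c p))"
    unfolding support_global_fun
    by (intro card_UN_disjoint finite_value1_patterns ballI impI fin)
      (auto simp: occs_def value1_patterns_def)
qed

lemma Sum_any_of_bool_diff:
  fixes a b :: "'a \<Rightarrow> bool"
  assumes "finite {i. a i}" and "finite {i. b i}"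
  shows "Sum_any (\<lambda>i. of_bool (a i) - of_bool (b i) :: int)
    = int (card {i. a i}) - int (card {i. b i})"
proof -
  let ?A = "{i. a i} \<union> {i. b i}"
  \<comment> \<open>The summand vanishes wherever \<open>a\<close> and \<open>b\<close> agree, so
    its support lies in the finite set \<open>?A\<close>.\<close>
  have "Sum_any (\<lambda>i. of_bool (a i) - of_bool (b i) :: int) = (\<Sum>i\<in>?A. of_bool (a i) - of_bool (b i))"
    using assms by (intro Sum_any.expand_superset) (auto simp: of_bool_def split: if_splits)
  also have "\<dots> = int (card (?A \<inter> {i. a i})) - int (card (?A \<inter> {i. b i}))"
    using assms by (simp add: sum_subtractf)
  finally show ?thesis
    by (simp add: Int_absorb1)
qed

text \<open>This turns number conservation into a count of pattern occurrences, the quantity that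
  bundling preserves.\<close>

lemma ncca_iff:
  "ncca m g \<longleftrightarrow> 1 \<le> m \<and> replicate m False \<notin> value1_patterns m g \<and>
     (\<forall>c. finite_config c \<longrightarrow> (\<Sum>p\<in>value1_patterns m g. card (occs c p)) = card {i. c i})"
proof (cases "replicate m False \<in> value1_patterns m g")
  case True
  \<comment> \<open>Every window of the zero configuration is the zero pattern, so its image is all
    ones and hence infinite.\<close>
  then have "global_fun m g (\<lambda>_. False) = (\<lambda>_. True)"
    by (auto simp: global_fun_def value1_patterns_def map_replicate_const)
  then have "\<not> finite_config (global_fun m g (\<lambda>_. False))"
    by (simp add: finite_config_def infinite_UNIV_int)
  moreover have "finite_config (\<lambda>_. False)"
    by (simp add: finite_config_def)
  ultimately show ?thesis
    using True unfolding ncca_def by blast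
next
  case False
  have "finite_config (global_fun m g c) \<and>
      Sum_any (\<lambda>i. of_bool (global_fun m g c i) - of_bool (c i) :: int) = 0 \<longleftrightarrow>
      (\<Sum>p\<in>value1_patterns m g. card (occs c p)) = card {i. c i}" if "finite_config c" for c
    using finite_config_global_fun[OF that False] that
      Sum_any_of_bool_diff[of "global_fun m g c" c]
    unfolding finite_config_def by (metis eq_iff_diff_eq_0 of_nat_eq_iff)
  then show ?thesis
    using False unfolding ncca_def by blast
qed

lemma sum_card_occs_bundle:
  assumes real: "realizes_bundle_pattern_set P \<B> Q"
    and card: "card P = 2 * card Q"
    and fin: "finite P"
    and nonzero: "\<And>r. r \<in> Q \<Longrightarrow> True \<in> set r"
    and c: "finite_config c"
  shows "(\<Sum>p\<in>P. card (occs c p)) = (\<Sum>r\<in>Q. card (occs c r))"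
proof -
  have part: "partition_on P \<B>"
    and card_B: "\<And>B. B \<in> \<B> \<Longrightarrow> card B = 2"
    and "\<And>B. B \<in> \<B> \<Longrightarrow> \<exists>r. bundle_pattern B r"
    and Q: "Q = {r. \<exists>B\<in>\<B>. bundle_pattern B r}"
    using real by (auto simp: realizes_bundle_pattern_set_def pair_partition_def)
  then obtain b where b: "\<And>B. B \<in> \<B> \<Longrightarrow> bundle_pattern B (b B)"
    by metis
  have P: "P = \<Union>\<B>" and disj: "disjoint \<B>"
    using part by (auto simp: partition_on_def)
  have fin\<B>: "finite \<B>" and finB: "\<And>B. B \<in> \<B> \<Longrightarrow> finite B"
    using fin P by (auto intro: finite_UnionD finite_subset)
  have bQ: "b B \<in> Q" if "B \<in> \<B>" for B
    using b that Q by blast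
  \<comment> \<open>\<open>Q\<close> is defined through a relation; uniqueness of the bundle pattern
    of a pair makes it the range of the chosen function \<open>b\<close>.\<close>
  have "b ` \<B> = Q"
  proof
    show "Q \<subseteq> b ` \<B>"
    proof
      fix r assume r: "r \<in> Q"
      then obtain B where B: "B \<in> \<B>" "bundle_pattern B r"
        using Q by blast
      moreover have "r \<noteq> []"
        using nonzero[OF r] by auto
      ultimately show "r \<in> b ` \<B>"
        using b bundle_pattern_unique by blast
    qed
  qed (use bQ in blast)
  moreover have "card P = 2 * card \<B>"
    using card_Union_disjoint[of \<B>] disj finB card_B
    by (simp add: P pairwise_def disjnt_def disjoint_def)
  \<comment> \<open>Two disjoint pairs {0r, 1r} and {r0, r1} could share their bundle pattern, which
    would then be counted once instead of twice. Counting excludes this: there are exactly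
    \<open>card Q\<close> pairs, and \<open>b\<close> maps them onto \<open>Q\<close>.\<close>
  ultimately have inj: "inj_on b \<B>"
    using card fin\<B> by (intro eq_card_imp_inj_on) auto
  have "(\<Sum>p\<in>P. card (occs c p)) = (\<Sum>B\<in>\<B>. \<Sum>p\<in>B. card (occs c p))"
    using sum.Union_disjoint[of \<B> "\<lambda>p. card (occs c p)"] disj finB
    by (simp add: P disjoint_def)
  also have "\<dots> = (\<Sum>B\<in>\<B>. card (occs c (b B)))"
    using b bQ nonzero c by (intro sum.cong card_occs_bundle) auto
  also have "\<dots> = (\<Sum>r\<in>Q. card (occs c r))"
    using inj \<open>b ` \<B> = Q\<close> by (metis (no_types, lifting) sum.reindex_cong)
  finally show ?thesis .
qed

lemma ncca_bundle_step:
  assumes "ncca (Suc m) g" and "1 \<le> m"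
    and real: "realizes_bundle_pattern_set (value1_patterns (Suc m) g) \<B> (value1_patterns m h)"
    and card: "card (value1_patterns (Suc m) g) = 2 * card (value1_patterns m h)"
  shows "ncca m h"
proof -
  \<comment> \<open>A zero bundle pattern would put the longer zero pattern into the value-1 set of
    \<open>g\<close>, which an NCCA forbids.\<close>
  have zero: "replicate m False \<notin> value1_patterns m h"
  proof
    assume "replicate m False \<in> value1_patterns m h"
    then obtain B where "B \<in> \<B>" "bundle_pattern B (replicate m False)"
      using real by (auto simp: realizes_bundle_pattern_set_def)
    moreover have "\<Union>\<B> = value1_patterns (Suc m) g"
      using real
      by (auto simp: realizes_bundle_pattern_set_def pair_partition_def partition_on_def)
    ultimately have "replicate (Suc m) False \<in> value1_patterns (Suc m) g"
      using bundle_pattern_zero by blast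
    then show False
      using assms(1) by (simp add: ncca_iff)
  qed
  then have "True \<in> set r" if "r \<in> value1_patterns m h" for r
    using that by (auto simp: True_in_set_iff value1_patterns_def)
  then show ?thesis
    using assms(1,2) zero sum_card_occs_bundle[OF real card finite_value1_patterns]
    by (auto simp: ncca_iff)
qed

theorem corollary1:
  fixes n :: nat
    and f :: "nat \<Rightarrow> bool list \<Rightarrow> bool"
    and P :: "nat \<Rightarrow> bool list set"
    and \<B> :: "nat \<Rightarrow> bool list set set"
    and T :: "bool list set \<times> (bool list \<times> bool list) set"
  assumes "1 \<le> n"
    and "ncca n (f n)"
    and "bundle_tree n (f n) P \<B> T"
    and "\<And>i. 1 \<le> i \<Longrightarrow> i \<le> n \<Longrightarrow> value1_patterns i (f i) = P i"
  shows "\<forall>i\<in>{1..n}. ncca i (f i)"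
proof
  fix i assume "i \<in> {1..n}"
  then have "i \<le> n" "1 \<le> i" by auto
  then show "ncca i (f i)"
  \<comment> \<open>The induction descends from \<open>n\<close>, where the automaton is the given
    NCCA, to \<open>i\<close>; each step goes from \<open>Suc m\<close> to \<open>m\<close>.\<close>
  proof (induction rule: inc_induct)
    case base
    show ?case by (fact assms(2))
  next
    case (step m)
    then have m: "1 \<le> m" "Suc m \<le> n" by auto
    have card: "card (P k) = 2 ^ (k - 1)" if "k \<in> {1..n}" for k
      using assms(3) that by (simp add: bundle_tree_def)
    \<comment> \<open>With \<open>1 \<le> m\<close> the truncated exponent \<open>m - 1\<close> is a
      true predecessor, so the sizes 2^m and 2^(m-1) differ by the factor two.\<close>
    have "card (P (Suc m)) = 2 * card (P m)"
      using card[of m] card[of "Suc m"] m by (cases m) auto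
    moreover have "realizes_bundle_pattern_set (P (Suc m)) (\<B> (Suc m)) (P (Suc m - 1))"
      using assms(3) m unfolding bundle_tree_def
      by (metis Suc_le_mono atLeastAtMost_iff numeral_2_eq_2 One_nat_def)
    ultimately show ?case
      using step m assms(4)[of m] assms(4)[of "Suc m"]
      by (intro ncca_bundle_step[of m "f (Suc m)" "\<B> (Suc m)"]) auto
  qed
qed

end
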